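(* For any $d\ge 1$, there exists a primitive $d$-dimensional block substitution $\mu_d$ which produces the $d$-dimensional paperfolding structures.
   Context: Crease patterns. For $\boldsymbol{x}\in\mathbb{Z}^d$ and $k\in\{1,\dots,d\}$ let $F_k(\boldsymbol{x})=\{y\in\mathbb{R}^d: y_k=x_k,\ x_i\le y_i\le x_i+1 \text{ for } i\ne k\}$ be the unit face perpendicular to the $k$-th axis. A crease pattern on a set of such faces assigns to each of them a sign $+$ (valley) or $-$ (crest). For a crease pattern $P$, $m_i'P$ denotes the pattern obtained by reflecting $P$ in the hyperplane $x_i=0$ and then exchanging all signs $+\leftrightarrow-$. The $m_i'$ are commuting involutions. For $\boldsymbol\phi\in\{1,-1\}^d$ put $M(\boldsymbol\phi)=\prod_{\{i:\phi_i=-1\}}m_i'$. Finite paperfolding structures. $S_d(n)$ is a crease pattern on the unit faces lying in $[-2^{n-1},2^{n-1}]^d$ but not in its boundary, defined recursively: $S_d(0)=\emptyset$, and $S_d(n+1)$ is obtained as follows. (i) A face $F_k(\boldsymbol{x})$ with $x_k=0$ gets the sign $\mathrm{sign}\big(\prod_{i<k}\sigma_i\big)$, where $\sigma_i=1$ if $x_i\ge0$ and $\sigma_i=-1$ if $x_i<0$ (empty product $=1$). (ii) For each $\boldsymbol\phi\in\{\pm1\}^d$, the faces with relative interior in the open orthant $\{\phi_iy_i>0\ \forall i\}$ carry the copy of $M(\boldsymbol\phi)S_d(n)$ translated so that its centre is $2^{n-1}\boldsymbol\phi$. (This is the crease pattern of a cubic $d$-dimensional paper folded $n$ times in each direction and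 unfolded again.) The patterns $S_d(n)$ stabilise on growing cubes around the origin as $n\to\infty$; the $d$-dimensional paperfolding structure is the limiting pattern on all of $\mathbb{R}^d$. Block substitutions. A $d$-dimensional block substitution $\rho$ on a finite alphabet $A$ (here with linear factor $2$) maps each letter to a $2\times\cdots\times2$ ($2^d$) block of letters, i.e. to a function $\{0,1\}^d\to A$. It acts on arrays $w$ indexed by subsets of $\mathbb{Z}^d$ by letting the letter of $\rho(w)$ at $2\boldsymbol{x}+\boldsymbol\delta$ ($\boldsymbol\delta\in\{0,1\}^d$) be $\rho(w_{\boldsymbol{x}})(\boldsymbol\delta)$. It is primitive if there is an integer $k$ such that for every letter $\alpha\in A$ the iterate $\rho^k(\alpha)$ contains all letters of $A$. Producing. Each letter represents a type of semi-cube, i.e. a half-open unit cube $\boldsymbol{x}+[0,1)^d$ carrying (possibly among other finite information) signs on its $d$ faces $F_1(\boldsymbol{x}),\dots,F_d(\boldsymbol{x})$; thus each letter determines an element of $\{+,-\}^d$, and an array of letters determines a crease pattern. The substitution produces the paperfolding structures if there is a seed, an array of letters on $\{-1,0\}^d$, such that for all $n\ge0$ the $n$-th iterate of the seed (an array on $\{-2^n,\dots,2^n-1\}^d$) determines exactly the crease signs of $S_d(n+2)$ on the faces $F_k(\boldsymbol{x})$, $\boldsymbol{x}\in\{-2^n,\dots,2^n-1\}^d$, $1\le k\le d$. *)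

theory Defs
  imports Main "HOL-Library.FuncSet"
begin

(* The lattice Z^d: coordinates are indexed 0, ..., d-1 and are undefined elsewhere, so that
   equality of points is equality of their d coordinates. *)
type_synonym point = "nat \<Rightarrow> int"

definition points :: "nat \<Rightarrow> point set" where
  "points d = {..<d} \<rightarrow>\<^sub>E UNIV"

datatype crease = Valley | Crest  (* + and - *)

fun flip :: "crease \<Rightarrow> crease" where
  "flip Valley = Crest"
| "flip Crest = Valley"

definition crease_of :: "int \<Rightarrow> crease" where
  "crease_of p = (if p > 0 then Valley else Crest)"

(* The pair (k, x) stands for the unit face
   F_k(x) = {y in R^d. y_k = x_k and x_i <= y_i <= x_i + 1 for i ~= k}.
   A crease pattern is defined exactly on the faces in its domain. *)
type_synonym face = "nat \<times> point"
type_synonym crease_pattern = "face \<Rightarrow> crease option"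

(* The faces contained in [-N, N]^d but not in its boundary. *)
definition inner_faces :: "nat \<Rightarrow> int \<Rightarrow> face set" where
  "inner_faces d N = {(k, x). k < d \<and> x \<in> points d \<and> - N < x k \<and> x k < N \<and>
     (\<forall>i<d. i \<noteq> k \<longrightarrow> - N \<le> x i \<and> x i + 1 \<le> N)}"

(* The mirror image of F_k(x) in the hyperplane x_i = 0: for i ~= k the interval [x_i, x_i + 1]
   is mapped to [- x_i - 1, - x_i]. *)
definition reflect_face :: "nat \<Rightarrow> face \<Rightarrow> face" where
  "reflect_face i = (\<lambda>(k, x). (k, x(i := (if i = k then - x i else - x i - 1))))"

(* m_i'; a reflection is its own inverse. *)
definition mirror_flip :: "nat \<Rightarrow> crease_pattern \<Rightarrow> crease_pattern" where
  "mirror_flip i P = (\<lambda>F. map_option flip (P (reflect_face i F)))"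

(* M(phi); the order of composition is immaterial, as the mirror_flip i commute. *)
definition mirror_flips :: "nat \<Rightarrow> (nat \<Rightarrow> int) \<Rightarrow> crease_pattern \<Rightarrow> crease_pattern" where
  "mirror_flips d \<phi> = fold mirror_flip (filter (\<lambda>i. \<phi> i = - 1) [0..<d])"

definition translate :: "nat \<Rightarrow> (nat \<Rightarrow> int) \<Rightarrow> crease_pattern \<Rightarrow> crease_pattern" where
  "translate d v P = (\<lambda>(k, x). P (k, \<lambda>i\<in>{..<d}. x i - v i))"

definition side :: "int \<Rightarrow> int" where
  "side a = (if a \<ge> 0 then 1 else - 1)"

(* The pattern S_d(n). If x_k ~= 0, the relative interior of F_k(x) lies in exactly one open
   orthant, namely that of phi_i = side (x_i). For n = 0 the (truncated) centre 2^(n-1) phi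
   is irrelevant, because S_d(0) is empty. *)
fun paperfolding :: "nat \<Rightarrow> nat \<Rightarrow> crease_pattern" where
  "paperfolding d 0 = Map.empty"
| "paperfolding d (Suc n) = (\<lambda>(k, x).
     if (k, x) \<notin> inner_faces d (2 ^ n) then None
     else if x k = 0 then Some (crease_of (\<Prod>i<k. side (x i)))
     else let \<phi> = (\<lambda>i. side (x i))
          in translate d (\<lambda>i. 2 ^ (n - 1) * \<phi> i) (mirror_flips d \<phi> (paperfolding d n)) (k, x))"

definition unit_block :: "nat \<Rightarrow> point set" where
  "unit_block d = {..<d} \<rightarrow>\<^sub>E {0, 1}"

(* A substitution maps a letter to its block, a function on unit_block d. *)
type_synonym 'a substitution = "'a \<Rightarrow> point \<Rightarrow> 'a"

definition block_substitution :: "nat \<Rightarrow> 'a set \<Rightarrow> 'a substitution \<Rightarrow> bool" where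
  "block_substitution d A \<rho> \<longleftrightarrow> finite A \<and> (\<forall>a\<in>A. \<forall>\<delta>\<in>unit_block d. \<rho> a \<delta> \<in> A)"

(* An array of letters, defined on a subset (the domain) of Z^d. *)
type_synonym 'a array = "point \<Rightarrow> 'a option"

(* Every y in Z^d is uniquely 2x + delta with delta in {0,1}^d: x_i = y_i div 2 (rounded
   downwards) and delta_i = y_i mod 2. *)
definition subst_array :: "nat \<Rightarrow> 'a substitution \<Rightarrow> 'a array \<Rightarrow> 'a array" where
  "subst_array d \<rho> w = (\<lambda>y. if y \<in> points d
     then map_option (\<lambda>a. \<rho> a (\<lambda>i\<in>{..<d}. y i mod 2)) (w (\<lambda>i\<in>{..<d}. y i div 2))
     else None)"

(* rho^k(a), as an array on {0, ..., 2^k - 1}^d. *)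
definition iterated_block :: "nat \<Rightarrow> 'a substitution \<Rightarrow> nat \<Rightarrow> 'a \<Rightarrow> 'a array" where
  "iterated_block d \<rho> k a = (subst_array d \<rho> ^^ k) [(\<lambda>i\<in>{..<d}. 0) \<mapsto> a]"

definition primitive :: "nat \<Rightarrow> 'a set \<Rightarrow> 'a substitution \<Rightarrow> bool" where
  "primitive d A \<rho> \<longleftrightarrow> (\<exists>k. \<forall>a\<in>A. A \<subseteq> ran (iterated_block d \<rho> k a))"

definition cube :: "nat \<Rightarrow> nat \<Rightarrow> point set" where
  "cube d n = {..<d} \<rightarrow>\<^sub>E {- (2 ^ n)..2 ^ n - 1}"

(* creases a k is the sign which a semi-cube of type a at x carries on its face F_k(x). *)
definition produces_paperfolding ::
    "nat \<Rightarrow> 'a set \<Rightarrow> ('a \<Rightarrow> nat \<Rightarrow> crease) \<Rightarrow> 'a substitution \<Rightarrow> bool" where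
  "produces_paperfolding d A creases \<rho> \<longleftrightarrow>
     (\<exists>seed :: 'a array. dom seed = cube d 0 \<and> ran seed \<subseteq> A \<and>
       (\<forall>n. \<forall>x\<in>cube d n. \<forall>k<d. \<exists>a.
          (subst_array d \<rho> ^^ n) seed x = Some a \<and>
          paperfolding d (n + 2) (k, x) = Some (creases a k)))"

end

theory Submission
  imports Defs "HOL-Library.Nat_Bijection"
begin

text \<open>
  Attach to every semi-cube \<open>x\<close> the signs of its faces together with the parities of its
  coordinates. This is enough information to subdivide. Put \<open>\<beta>(a) = 1\<close> for odd and \<open>\<beta>(a) = -1\<close> for
  even \<open>a\<close>, and consider a face \<open>F\<^sub>k(y)\<close> with \<open>y = 2x + \<delta>\<close>.

  If \<open>\<delta>\<^sub>k = 0\<close>, the face is part of the doubled face \<open>2 F\<^sub>k(x)\<close> and inherits the sign of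
  \<open>F\<^sub>k(x)\<close>: doubling all coordinates commutes with the recursive construction (\<open>fold_sign_even\<close>). If \<open>\<delta>\<^sub>k = 1\<close>, the face lies on an odd hyperplane, where the pattern is
  periodic: from \<open>S\<^sub>d(3)\<close> onwards its sign is the product of all \<open>\<beta>(\<delta>\<^sub>i)\<close> with \<open>i < k\<close> and all \<open>\<beta>(x\<^sub>i)\<close>
  with \<open>i \<ge> k\<close> (\<open>fold_sign_odd\<close>). The reason is that one step of the recursion multiplies the sign by
  \<open>side(y\<^sub>i)\<close> for every \<open>i\<close>, while the reflection in \<open>y\<^sub>i = 0\<close>, applied exactly when
  \<open>side(y\<^sub>i) = -1\<close>, complements the binary digits that determine the factor with index \<open>i\<close>; hence both
  sides of the formula change in the same way.

  Both rules use only the letter at \<open>x\<close> and \<open>\<delta>\<close>, and \<open>\<delta>\<close> gives the new parities. So they define a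
  substitution on all pairs (signs, parities), for which the signs of \<open>S\<^sub>d(2)\<close>
  and the parities of the coordinates are a seed.

  The substitution is primitive on this full alphabet because the parities can be steered freely.
  The products of \<open>\<beta>(p\<^sub>i)\<close> over \<open>i \<ge> k\<close>, one for each \<open>k\<close>, can be prescribed by the choice of
  \<open>p\<close> (\<open>suffix_products_solvable\<close>). From any letter, choosing \<open>\<delta> = p\<close> and then
  \<open>\<delta> = (1,\<dots>,1)\<close> writes arbitrary signs; two further steps adjust the parities and keep the signs.
\<close>

section \<open>Folding signs as integers\<close>

text \<open>
  The position, relative to the centre and after undoing the reflections, of the face
  \<open>F\<^sub>k(x)\<close> of \<open>S\<^sub>d(n + 1)\<close> in the copy of \<open>S\<^sub>d(n)\<close> that contains it. A reflection negates a coordinate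
  of a hyperplane (\<open>i = k\<close>), but maps the unit interval starting at \<open>x\<^sub>i\<close> to the one
  starting at \<open>- x\<^sub>i - 1\<close>.
\<close>

definition fold_face :: "nat \<Rightarrow> nat \<Rightarrow> nat \<Rightarrow> point \<Rightarrow> point" where
  "fold_face d n k x = (\<lambda>i\<in>{..<d}.
     (if i = k then \<bar>x i\<bar> else if x i \<ge> 0 then x i else - x i - 1) - 2 ^ (n - 1))"

text \<open>
  The sign of a face of \<open>S\<^sub>d(n)\<close> as \<open>1\<close> or \<open>- 1\<close>, without the domain restriction. The value for
  \<open>n = 0\<close> is arbitrary: a face in the domain reaches \<open>x\<^sub>k = 0\<close> before the recursion gets there.
\<close>

fun fold_sign :: "nat \<Rightarrow> nat \<Rightarrow> nat \<Rightarrow> point \<Rightarrow> int" where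
  "fold_sign d 0 k x = 1"
| "fold_sign d (Suc n) k x =
     (if x k = 0 then \<Prod>i<k. side (x i)
      else (\<Prod>i<d. side (x i)) * fold_sign d n k (fold_face d n k x))"

lemma prod_sign:
  fixes f :: "'b \<Rightarrow> int"
  assumes "\<And>i. i \<in> I \<Longrightarrow> f i = 1 \<or> f i = - 1"
  shows "prod f I = 1 \<or> prod f I = - 1"
  using assms
proof (induction I rule: infinite_finite_induct)
  case (insert a I)
  then have "prod f I = 1 \<or> prod f I = - 1" and "f a = 1 \<or> f a = - 1" by blast+
  with insert.hyps show ?case by auto
qed simp_all

lemma side_sign: "side a = 1 \<or> side a = - 1"
  by (simp add: side_def)

lemma prod_side_sign: "(\<Prod>i\<in>I. side (x i)) = 1 \<or> (\<Prod>i\<in>I. side (x i)) = - 1"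
  by (rule prod_sign) (rule side_sign)

lemma fold_sign_sign: "fold_sign d n k x = 1 \<or> fold_sign d n k x = - 1"
proof (induction n arbitrary: x)
  case (Suc n)
  show ?case
    using Suc[of "fold_face d n k x"] prod_side_sign[of x "{..<d}"] prod_side_sign[of x "{..<k}"]
    by auto
qed simp

text \<open>
  For a list without repetitions the reflections act on different coordinates, so that the composite
  reflects each listed coordinate exactly once, while every reflection contributes one \<open>flip\<close>.
\<close>

lemma fold_mirror_flip:
  assumes "distinct l"
  shows "fold mirror_flip l P (k, x) = map_option (flip ^^ length l)
    (P (k, \<lambda>i. if i \<in> set l then (if i = k then - x i else - x i - 1) else x i))"
  using assms
proof (induction l arbitrary: P)
  case (Cons a l)
  let ?r = "\<lambda>l i. if i \<in> set l then (if i = k then - x i else - x i - 1) else x i"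
  have upd: "(?r l)(a := (if a = k then - ?r l a else - ?r l a - 1)) = ?r (a # l)"
    using Cons.prems by auto
  have "fold mirror_flip (a # l) P (k, x) = map_option (flip ^^ length l) (mirror_flip a P (k, ?r l))"
    using Cons by simp
  also have "mirror_flip a P (k, ?r l) = map_option flip (P (k, ?r (a # l)))"
    unfolding mirror_flip_def reflect_face_def prod.case upd ..
  also have "map_option (flip ^^ length l) (map_option flip (P (k, ?r (a # l)))) =
      map_option (flip ^^ length (a # l)) (P (k, ?r (a # l)))"
    by (simp add: option.map_comp funpow_Suc_right del: funpow.simps)
  finally show ?case .
qed (simp add: option.map_id0)

lemma flip_funpow_crease_of:
  assumes "v = 1 \<or> v = - 1"
  shows "(flip ^^ m) (crease_of v) = crease_of ((- 1) ^ m * v)"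
proof -
  have "flip (crease_of u) = crease_of (- u)" if "u = 1 \<or> u = - 1" for u
    using that by (auto simp: crease_of_def)
  moreover have "(- 1) ^ j * v = 1 \<or> (- 1) ^ j * v = - 1" for j :: nat
    using assms by (cases "even j") auto
  ultimately show ?thesis by (induction m) auto
qed

lemma prod_side_eq_power:
  "(\<Prod>i<d. side (x i)) = (- 1) ^ length (filter (\<lambda>i. side (x i) = - 1) [0..<d])"
proof (induction d)
  case (Suc d)
  then show ?case using side_sign[of "x d"] by auto
qed simp

lemma fold_face_inner:
  assumes "(k, x) \<in> inner_faces d (2 ^ Suc n)" and "x k \<noteq> 0"
  shows "(k, fold_face d (Suc n) k x) \<in> inner_faces d (2 ^ n)"
  using assms unfolding inner_faces_def points_def fold_face_def by force

text \<open>
  Passing from the pattern to the copy that contains the face costs one \<open>flip\<close> for every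
  negative coordinate, which in terms of integers is the product of all the sides.
\<close>

lemma paperfolding_eq_fold_sign:
  assumes "(k, x) \<in> inner_faces d (2 ^ n)"
  shows "paperfolding d (Suc n) (k, x) = Some (crease_of (fold_sign d (Suc n) k x))"
  using assms
proof (induction n arbitrary: x)
  case 0
  then have "x k = 0" by (simp add: inner_faces_def)
  with 0 show ?case by simp
next
  case (Suc n)
  show ?case
  proof (cases "x k = 0")
    case True
    with Suc show ?thesis by simp
  next
    case False
    let ?l = "filter (\<lambda>i. side (x i) = - 1) [0..<d]"
    let ?y = "\<lambda>i\<in>{..<d}. x i - 2 ^ n * side (x i)"
    have k: "k < d" and x: "x \<in> points d" using Suc.prems by (auto simp: inner_faces_def)
    have eq: "(\<lambda>i. if i \<in> set ?l then (if i = k then - ?y i else - ?y i - 1) else ?y i)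
        = fold_face d (Suc n) k x"
      using k by (auto simp: fold_face_def side_def fun_eq_iff)
    have "paperfolding d (Suc (Suc n)) (k, x) =
        fold mirror_flip ?l (paperfolding d (Suc n)) (k, ?y)"
      using Suc.prems False
      by (simp add: translate_def mirror_flips_def del: paperfolding.simps(2) add: paperfolding.simps(2)[of d "Suc n"])
    also have "\<dots> = map_option (flip ^^ length ?l) (paperfolding d (Suc n) (k, fold_face d (Suc n) k x))"
      by (subst fold_mirror_flip) (simp_all only: eq distinct_filter distinct_upt)
    also have "\<dots> = Some ((flip ^^ length ?l) (crease_of (fold_sign d (Suc n) k (fold_face d (Suc n) k x))))"
      by (simp only: Suc.IH[OF fold_face_inner[OF Suc.prems False]] option.map)
    also have "\<dots> = Some (crease_of (fold_sign d (Suc (Suc n)) k x))"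
      unfolding flip_funpow_crease_of[OF fold_sign_sign]
      using False prod_side_eq_power[of x d] by simp
    finally show ?thesis .
  qed
qed

section \<open>Self-similarity and the signs on odd hyperplanes\<close>

text \<open>
  Self-similarity: halving the coordinates preserves sides, and it commutes with \<open>fold_face\<close>, since
  \<open>- y - 1\<close> halves to \<open>- (y div 2) - 1\<close>. The bound on \<open>y k\<close> starts the induction: in \<open>S\<^sub>d(2)\<close> the only
  even coordinate of a hyperplane is \<open>0\<close>.
\<close>

lemma fold_sign_even:
  assumes "k < d" and "even (y k)" and "\<bar>y k\<bar> < 2 ^ Suc n"
  shows "fold_sign d (Suc (Suc n)) k y = fold_sign d (Suc n) k (\<lambda>i\<in>{..<d}. y i div 2)"
  using assms(2,3)
proof (induction n arbitrary: y)
  case 0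
  then have "y k = 0" by (auto elim!: evenE)
  then show ?case using assms(1) by (auto simp: side_def intro!: prod.cong)
next
  case (Suc n)
  let ?x = "\<lambda>i\<in>{..<d}. y i div 2"
  have sides: "(\<Prod>i\<in>I. side (y i)) = (\<Prod>i\<in>I. side (?x i))" if "I \<subseteq> {..<d}" for I
    using that by (intro prod.cong) (auto simp: side_def)
  show ?case
  proof (cases "y k = 0")
    case True
    then show ?thesis using assms(1) sides[of "{..<k}"] by auto
  next
    case False
    then have x: "?x k \<noteq> 0" using assms(1) Suc.prems(1) by (auto elim!: evenE)
    let ?z = "fold_face d (Suc (Suc n)) k y"
    have "even (?z k)" "\<bar>?z k\<bar> < 2 ^ Suc n"
      using assms(1) Suc.prems False by (auto simp: fold_face_def)
    note IH = Suc.IH[of ?z, OF this]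
    have "(if i = k then \<bar>y i\<bar> else if y i \<ge> 0 then y i else - y i - 1) div 2
        = (if i = k then \<bar>y i div 2\<bar> else if y i div 2 \<ge> 0 then y i div 2 else - (y i div 2) - 1)" for i
      using Suc.prems(1) by (auto elim!: evenE)
    moreover have "(u - 2 * 2 ^ n) div 2 = u div 2 - 2 ^ n" for u :: int
      by (metis div_mult_self2 mult_minus_right uminus_add_conv_diff add.commute zero_neq_numeral)
    ultimately have "(\<lambda>i\<in>{..<d}. ?z i div 2) = fold_face d (Suc n) k ?x"
      by (auto simp: fold_face_def fun_eq_iff)
    with IH False x sides[of "{..<d}"] show ?thesis
      by (simp only: fold_sign.simps(2)[of d "Suc (Suc n)"] fold_sign.simps(2)[of d "Suc n" k ?x] if_False order_refl)
  qed
qed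

definition odd_sign :: "int \<Rightarrow> int" where
  "odd_sign a = (if odd a then 1 else - 1)"

lemma odd_sign_sign: "odd_sign a = 1 \<or> odd_sign a = - 1"
  by (simp add: odd_sign_def)

lemma odd_sign_one: "odd_sign 1 = 1"
  by (simp add: odd_sign_def)

lemma prod_split_at:
  fixes f :: "nat \<Rightarrow> 'b::comm_monoid_mult"
  assumes "k < d"
  shows "prod f {..<d} = prod f {..<k} * prod f {k..<d}"
  using assms by (metis less_imp_le_nat prod.atLeastLessThan_concat atLeast0LessThan zero_le)

text \<open>
  In \<open>S\<^sub>d(2)\<close> a coordinate has only two binary digits, and its second digit is its sign. This is why
  \<open>side (y i)\<close> appears here in the place where larger patterns have \<open>odd_sign (y i div 2)\<close>.
\<close>

lemma fold_sign_odd_two: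
  assumes "(k, y) \<in> inner_faces d 2" and "odd (y k)"
  shows "fold_sign d 2 k y = (\<Prod>i<k. odd_sign (y i)) * (\<Prod>i=k..<d. side (y i))"
proof -
  have k: "k < d" and r: "\<And>i. i < d \<Longrightarrow> i \<noteq> k \<Longrightarrow> - 2 \<le> y i \<and> y i \<le> 1"
    using assms(1) by (force simp: inner_faces_def)+
  have yk: "y k = 1 \<or> y k = - 1"
    using assms by (auto simp: inner_faces_def) presburger+
  have bit: "odd_sign (y i) = side (y i) * side (fold_face d 1 k y i)" if "i < k" for i
  proof -
    have "y i = - 2 \<or> y i = - 1 \<or> y i = 0 \<or> y i = 1" using r[of i] k that by auto
    then show ?thesis using that k by (auto simp: odd_sign_def side_def fold_face_def)
  qed
  have "fold_face d 1 k y k = 0" using yk k by (auto simp: fold_face_def)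
  then have "fold_sign d 2 k y = (\<Prod>i<d. side (y i)) * (\<Prod>i<k. side (fold_face d 1 k y i))"
    using yk by (auto simp: numeral_2_eq_2)
  also have "\<dots> = (\<Prod>i<k. side (y i) * side (fold_face d 1 k y i)) * (\<Prod>i=k..<d. side (y i))"
    by (simp add: prod_split_at[OF k] prod.distrib mult_ac)
  also have "\<dots> = (\<Prod>i<k. odd_sign (y i)) * (\<Prod>i=k..<d. side (y i))"
    using bit by simp
  finally show ?thesis .
qed

text \<open>
  The inductive step of the closed form for odd hyperplanes. If every factor changes by
  \<open>side (y i)\<close>, the total change cancels the product of all sides in the recursion. The functions
  \<open>f\<close> and \<open>g\<close> differ only in the passage from \<open>S\<^sub>d(2)\<close> to \<open>S\<^sub>d(3)\<close>.
\<close>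

lemma fold_sign_odd_step:
  fixes f g :: "int \<Rightarrow> int"
  assumes k: "k < d" and "y k \<noteq> 0"
    and z: "fold_sign d n k z = (\<Prod>i<k. odd_sign (z i)) * (\<Prod>i=k..<d. f (z i))"
    and zdef: "z = fold_face d n k y"
    and low: "\<And>i. i < k \<Longrightarrow> odd_sign (z i) = side (y i) * odd_sign (y i)"
    and high: "\<And>i. k \<le> i \<Longrightarrow> i < d \<Longrightarrow> f (z i) = side (y i) * g (y i)"
  shows "fold_sign d (Suc n) k y = (\<Prod>i<k. odd_sign (y i)) * (\<Prod>i=k..<d. g (y i))"
proof -
  have sq: "(\<Prod>i\<in>I. side (y i)) * ((\<Prod>i\<in>I. side (y i)) * c) = c" for I c
    using prod_side_sign[of y I] by auto
  have "(\<Prod>i<k. odd_sign (z i)) = (\<Prod>i<k. side (y i)) * (\<Prod>i<k. odd_sign (y i))"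
    using low by (simp add: prod.distrib)
  moreover have "(\<Prod>i=k..<d. f (z i)) = (\<Prod>i=k..<d. side (y i)) * (\<Prod>i=k..<d. g (y i))"
    using high by (simp add: prod.distrib)
  moreover have "fold_sign d (Suc n) k y = (\<Prod>i<k. side (y i)) * (\<Prod>i=k..<d. side (y i)) * fold_sign d n k z"
    using assms(2) by (simp add: zdef prod_split_at[OF k])
  ultimately have "fold_sign d (Suc n) k y = (\<Prod>i<k. side (y i)) * ((\<Prod>i<k. side (y i)) *
      ((\<Prod>i=k..<d. side (y i)) * ((\<Prod>i=k..<d. side (y i)) *
        ((\<Prod>i<k. odd_sign (y i)) * (\<Prod>i=k..<d. g (y i))))))"
    by (simp add: z mult_ac)
  then show ?thesis by (simp only: sq)
qed

text \<open>
  Folding complements the binary digits of a negative coordinate, and in the inductive step the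
  translation is by a multiple of \<open>4\<close>. For \<open>i \<noteq> k\<close> the parities of \<open>y i\<close> and of \<open>y i div 2\<close> therefore
  change exactly when \<open>side (y i) = - 1\<close>. The coordinate \<open>y k\<close> is negated instead; it is odd, so
  that this complements the parity of \<open>y k div 2\<close> as well, and its own parity does not occur.
\<close>

lemma fold_sign_odd:
  assumes "(k, y) \<in> inner_faces d (2 ^ Suc (Suc n))" and "odd (y k)"
  shows "fold_sign d (Suc (Suc (Suc n))) k y =
    (\<Prod>i<k. odd_sign (y i)) * (\<Prod>i=k..<d. odd_sign (y i div 2))"
  using assms
proof (induction n arbitrary: y)
  case 0
  let ?z = "fold_face d 2 k y"
  have k: "k < d" and nz: "y k \<noteq> 0" and yk: "- 4 < y k" "y k < 4"
    and r: "\<And>i. i < d \<Longrightarrow> i \<noteq> k \<Longrightarrow> - 4 \<le> y i \<and> y i \<le> 3"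
    using 0 by (force simp: inner_faces_def)+
  have inner: "(k, ?z) \<in> inner_faces d 2"
    using fold_face_inner[of k y d 1] 0 nz by (simp add: numeral_2_eq_2)
  have odd: "odd (?z k)" using 0(2) k by (simp add: fold_face_def)
  have "fold_sign d (Suc 2) k y = (\<Prod>i<k. odd_sign (y i)) * (\<Prod>i=k..<d. odd_sign (y i div 2))"
  proof (rule fold_sign_odd_step[OF k nz fold_sign_odd_two[OF inner odd] refl])
    show "odd_sign (?z i) = side (y i) * odd_sign (y i)" if "i < k" for i
      using that k by (auto simp: odd_sign_def side_def fold_face_def)
    \<comment> \<open>a folded coordinate is between \<open>0\<close> and \<open>3\<close> before the translation
      by \<open>- 2\<close>, so its upper digit becomes the sign\<close>
    show "side (?z i) = side (y i) * odd_sign (y i div 2)" if "i < d" for i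
    proof (cases "i = k")
      case True
      have "y k = - 3 \<or> y k = - 1 \<or> y k = 1 \<or> y k = 3" using yk 0(2) by presburger
      then show ?thesis using True k by (auto simp: odd_sign_def side_def fold_face_def)
    next
      case False
      have "y i = - 4 \<or> y i = - 3 \<or> y i = - 2 \<or> y i = - 1 \<or> y i = 0 \<or> y i = 1 \<or> y i = 2 \<or> y i = 3"
        using r[OF that False] by presburger
      then show ?thesis using False that by (auto simp: odd_sign_def side_def fold_face_def)
    qed
  qed
  then show ?case by (simp add: numeral_2_eq_2)
next
  case (Suc n)
  let ?z = "fold_face d (Suc (Suc (Suc n))) k y"
  have k: "k < d" using Suc.prems by (simp add: inner_faces_def)
  have nz: "y k \<noteq> 0" using Suc.prems(2) by auto
  have odd: "odd (?z k)" using Suc.prems(2) k by (simp add: fold_face_def)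
  have "(u - 4 * 2 ^ n) div 2 = u div 2 - 2 * 2 ^ n" for u :: int by presburger
  note half = this
  show ?case
  proof (rule fold_sign_odd_step[OF k nz Suc.IH[OF fold_face_inner[OF Suc.prems(1) nz] odd] refl])
    show "odd_sign (?z i) = side (y i) * odd_sign (y i)" if "i < k" for i
      using that k by (auto simp: odd_sign_def side_def fold_face_def)
    show "odd_sign (?z i div 2) = side (y i) * odd_sign (y i div 2)" if "i < d" for i
    proof -
      have "odd ((- a - 1) div 2) \<longleftrightarrow> even (a div 2)" for a :: int by presburger
      moreover have "odd (- a div 2) \<longleftrightarrow> even (a div 2)" if "odd a" for a :: int
        using that by presburger
      ultimately show ?thesis using that Suc.prems(2)
        by (auto simp: odd_sign_def side_def fold_face_def half)
    qed
  qed
qed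

section \<open>The substitution\<close>

text \<open>
  A letter consists of \<open>d\<close> signs and \<open>d\<close> parities; it is coded as the number whose binary digits
  \<open>0, \<dots>, d - 1\<close> are the signs and whose digits \<open>d, \<dots>, 2 d - 1\<close> are the parities.
\<close>

definition letter :: "nat \<Rightarrow> (nat \<Rightarrow> int) \<Rightarrow> point \<Rightarrow> nat" where
  "letter d s p = set_encode ({k. k < d \<and> s k = 1} \<union> (+) d ` {k. k < d \<and> odd (p k)})"

definition letter_sign :: "nat \<Rightarrow> nat \<Rightarrow> int" where
  "letter_sign a k = (if k \<in> set_decode a then 1 else - 1)"

definition letter_parity :: "nat \<Rightarrow> nat \<Rightarrow> nat \<Rightarrow> int" where
  "letter_parity d a k = (if d + k \<in> set_decode a then 1 else 0)"

definition letters :: "nat \<Rightarrow> nat set" where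
  "letters d = set_encode ` Pow {..<d + d}"

definition fold_subst :: "nat \<Rightarrow> nat substitution" where
  "fold_subst d a \<delta> = letter d
     (\<lambda>k. if even (\<delta> k) then letter_sign a k
          else (\<Prod>i<k. odd_sign (\<delta> i)) * (\<Prod>i=k..<d. odd_sign (letter_parity d a i))) \<delta>"

lemma finite_letters: "finite (letters d)"
  by (simp add: letters_def)

lemma letter_in_letters: "letter d s p \<in> letters d"
  unfolding letter_def letters_def by (intro imageI) auto

lemma set_decode_letter:
  "set_decode (letter d s p) = {k. k < d \<and> s k = 1} \<union> (+) d ` {k. k < d \<and> odd (p k)}"
  unfolding letter_def by (rule set_encode_inverse) simp

lemma letter_sign_letter:
  assumes "k < d" and "s k = 1 \<or> s k = - 1"
  shows "letter_sign (letter d s p) k = s k"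
  using assms unfolding letter_sign_def set_decode_letter by auto

lemma odd_sign_letter_parity:
  assumes "k < d"
  shows "odd_sign (letter_parity d (letter d s p) k) = odd_sign (p k)"
  using assms unfolding letter_parity_def set_decode_letter odd_sign_def by auto

lemma letter_cong:
  assumes "\<And>k. k < d \<Longrightarrow> s k = s' k" and "\<And>k. k < d \<Longrightarrow> odd (p k) \<longleftrightarrow> odd (p' k)"
  shows "letter d s p = letter d s' p'"
proof -
  have "{k. k < d \<and> s k = 1} = {k. k < d \<and> s' k = 1}"
    "{k. k < d \<and> odd (p k)} = {k. k < d \<and> odd (p' k)}"
    using assms by auto
  then show ?thesis by (simp add: letter_def)
qed

lemma letter_of_attributes:
  assumes "a \<in> letters d"
  shows "letter d (letter_sign a) (letter_parity d a) = a"
proof -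
  obtain B where B: "B \<subseteq> {..<d + d}" "a = set_encode B" using assms by (auto simp: letters_def)
  then have dec: "set_decode a = B" 
    using set_encode_inverse[of B] finite_subset[OF B(1)] by simp
  have "{k. k < d \<and> k \<in> B} \<union> (+) d ` {k. k < d \<and> d + k \<in> B} = B"
  proof (intro equalityI subsetI)
    fix j assume "j \<in> B"
    show "j \<in> {k. k < d \<and> k \<in> B} \<union> (+) d ` {k. k < d \<and> d + k \<in> B}"
    proof (cases "j < d")
      case False
      then have "j = d + (j - d)" by simp
      moreover have "j - d \<in> {k. k < d \<and> d + k \<in> B}"
        using False B(1) \<open>j \<in> B\<close> by auto
      ultimately show ?thesis by blast
    qed (use \<open>j \<in> B\<close> in simp)
  qed auto
  moreover have "{k. k < d \<and> letter_sign a k = 1} = {k. k < d \<and> k \<in> B}"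
    "{k. k < d \<and> odd (letter_parity d a k)} = {k. k < d \<and> d + k \<in> B}"
    by (auto simp: letter_sign_def letter_parity_def dec)
  ultimately show ?thesis by (simp add: letter_def B(2))
qed

lemma fold_subst_letter:
  assumes "\<And>k. k < d \<Longrightarrow> s k = 1 \<or> s k = - 1"
  shows "fold_subst d (letter d s p) \<delta> = letter d
     (\<lambda>k. if even (\<delta> k) then s k
          else (\<Prod>i<k. odd_sign (\<delta> i)) * (\<Prod>i=k..<d. odd_sign (p i))) \<delta>"
  unfolding fold_subst_def
  by (rule letter_cong) (simp_all add: letter_sign_letter assms odd_sign_letter_parity)

lemma block_substitution_fold_subst: "block_substitution d (letters d) (fold_subst d)"
  unfolding block_substitution_def fold_subst_def using letter_in_letters
  by (simp add: finite_letters)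

section \<open>Primitivity\<close>

lemma subst_array_ran:
  assumes "dom w \<subseteq> points d" and "b \<in> ran w" and \<delta>: "\<delta> \<in> unit_block d"
  shows "\<rho> b \<delta> \<in> ran (subst_array d \<rho> w)"
proof -
  obtain x where x: "w x = Some b" using assms(2) by (auto simp: ran_def)
  then have pt: "x \<in> points d" using assms(1) by auto
  let ?y = "\<lambda>i\<in>{..<d}. 2 * x i + \<delta> i"
  have bit: "\<delta> i = 0 \<or> \<delta> i = 1" if "i < d" for i using that \<delta> by (auto simp: unit_block_def)
  have *: "?y i div 2 = x i" "?y i mod 2 = \<delta> i" if "i < d" for i
    using bit[OF that] that by auto
  have "(\<lambda>i\<in>{..<d}. ?y i div 2) = x" "(\<lambda>i\<in>{..<d}. ?y i mod 2) = \<delta>"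
    using pt \<delta> * by (auto simp: fun_eq_iff points_def unit_block_def PiE_def extensional_def)
  moreover have "?y \<in> points d" by (auto simp: points_def)
  ultimately have "subst_array d \<rho> w ?y = Some (\<rho> b \<delta>)" using x by (simp add: subst_array_def)
  then show ?thesis unfolding ran_def by blast
qed

lemma dom_iterated_block: "dom (iterated_block d \<rho> k a) \<subseteq> points d"
  by (cases k) (auto simp: iterated_block_def points_def subst_array_def split: if_splits)

lemma iterated_block_step:
  assumes "b \<in> ran (iterated_block d \<rho> k a)" and "\<delta> \<in> unit_block d"
  shows "\<rho> b \<delta> \<in> ran (iterated_block d \<rho> (Suc k) a)"
  using subst_array_ran[OF dom_iterated_block assms] by (simp add: iterated_block_def)

text \<open>
  The equations for the suffix products form a triangular system: the factor at \<open>k\<close> occurs in no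
  equation for a larger index. They can therefore be solved from the last coordinate backwards, even
  if the coordinates outside \<open>Q\<close> have to be \<open>0\<close>.
\<close>

lemma suffix_products_solvable:
  fixes w :: "nat \<Rightarrow> int"
  assumes "\<And>k. k < d \<Longrightarrow> w k = 1 \<or> w k = - 1"
  shows "\<exists>p \<in> unit_block d. \<forall>k<d. if k \<in> Q then (\<Prod>i=k..<d. odd_sign (p i)) = w k else p k = 0"
proof -
  have "\<exists>p. \<forall>k<d. (p k = 0 \<or> p k = 1) \<and>
      (if k \<in> Q then (\<Prod>i=k..<d. odd_sign (p i)) = w k else p k = 0)"
    using assms
  proof (induction d arbitrary: w)
    case (Suc d)
    define c :: int where "c = (if d \<in> Q \<and> w d = 1 then 1 else 0)"
    have "w k * odd_sign c = 1 \<or> w k * odd_sign c = - 1" if "k < d" for k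
      using Suc.prems[of k] odd_sign_sign[of c] that by auto
    from Suc.IH[of "\<lambda>k. w k * odd_sign c", OF this] obtain p
      where p: "\<forall>k<d. (p k = 0 \<or> p k = 1) \<and>
        (if k \<in> Q then (\<Prod>i=k..<d. odd_sign (p i)) = w k * odd_sign c else p k = 0)"
      by blast
    have p_prod: "(\<Prod>i=k..<Suc d. odd_sign ((p(d := c)) i)) = (\<Prod>i=k..<d. odd_sign (p i)) * odd_sign c"
      if "k \<le> d" for k
      using that by simp
    have "(\<Prod>i=k..<Suc d. odd_sign ((p(d := c)) i)) = w k" if "k < Suc d" "k \<in> Q" for k
    proof (cases "k = d")
      case True
      then show ?thesis using p_prod[of d] Suc.prems[of d] that by (auto simp: c_def odd_sign_def)
    next
      case False
      then have "(\<Prod>i=k..<d. odd_sign (p i)) = w k * odd_sign c" using p that by auto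
      moreover have "odd_sign c * odd_sign c = 1" using odd_sign_sign[of c] by auto
      ultimately show ?thesis using p_prod[of k] that by (simp add: mult.assoc)
    qed
    moreover have "(p(d := c)) k = 0 \<or> (p(d := c)) k = 1" if "k < Suc d" for k
      using p that by (auto simp: c_def less_Suc_eq)
    moreover have "(p(d := c)) k = 0" if "k < Suc d" "k \<notin> Q" for k
      using p that by (auto simp: c_def less_Suc_eq)
    ultimately show ?case by (intro exI[of _ "p(d := c)"]) simp
  qed simp
  then obtain p where p: "\<forall>k<d. (p k = 0 \<or> p k = 1) \<and>
      (if k \<in> Q then (\<Prod>i=k..<d. odd_sign (p i)) = w k else p k = 0)" by blast
  have "(\<Prod>i=k..<d. odd_sign (restrict p {..<d} i)) = (\<Prod>i=k..<d. odd_sign (p i))" for k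
    by (intro prod.cong) auto
  moreover have "restrict p {..<d} \<in> unit_block d"
    using p by (auto simp: unit_block_def)
  moreover have "restrict p {..<d} k = p k" if "k < d" for k
    using that by simp
  ultimately show ?thesis using p by (intro bexI[of _ "restrict p {..<d}"]) presburger
qed

text \<open>
  Four steps lead from any letter \<open>a\<close> to any letter \<open>b\<close> with signs \<open>t\<close> and parities \<open>q\<close>. The blocks
  are entered at \<open>p\<close>, \<open>(1,\<dots>,1)\<close>, \<open>r\<close> and \<open>q\<close>. Entering at \<open>(1,\<dots>,1)\<close> replaces all signs by the
  suffix products of \<open>p\<close>, chosen to be \<open>t\<close>. In the last step the signs with \<open>q\<^sub>k = 1\<close> are recomputed
  from \<open>r\<close>, and the suffix products of \<open>r\<close> are chosen to give \<open>t\<^sub>k\<close>. The signs with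
  \<open>q\<^sub>k = 0\<close> are copied, so they have to survive the third step too; this is why \<open>r\<^sub>k = 0\<close> there.
\<close>

lemma primitive_fold_subst: "primitive d (letters d) (fold_subst d)"
  unfolding primitive_def
proof (intro exI ballI subsetI)
  fix a b assume a: "a \<in> letters d" and b: "b \<in> letters d"
  define t q where "t = letter_sign b" and "q = (\<lambda>i\<in>{..<d}. letter_parity d b i)"
  have b_eq: "b = letter d t q"
    using letter_of_attributes[OF b] letter_cong[of d t t q "letter_parity d b"]
    by (simp add: t_def q_def)
  have t: "t k = 1 \<or> t k = - 1" for k by (simp add: t_def letter_sign_def)
  have q: "q \<in> unit_block d" by (auto simp: q_def unit_block_def letter_parity_def)
  define one :: point where "one = (\<lambda>i\<in>{..<d}. 1)"
  have one: "one \<in> unit_block d" "\<And>i. i < d \<Longrightarrow> one i = 1"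
    by (auto simp: one_def unit_block_def)
  obtain p where p: "p \<in> unit_block d" "\<And>k. k < d \<Longrightarrow> (\<Prod>i=k..<d. odd_sign (p i)) = t k"
    using suffix_products_solvable[of d t UNIV] t by auto
  \<comment> \<open>the last step at \<open>q\<close> contributes the prefix product of \<open>q\<close>, which \<open>r\<close> has to compensate\<close>
  define w where "w k = t k * (\<Prod>i<k. odd_sign (q i))" for k
  have w: "w k = 1 \<or> w k = - 1" for k
    using t[of k] prod_sign[of "{..<k}" "\<lambda>i. odd_sign (q i)"] odd_sign_sign by (auto simp: w_def)
  obtain r where r: "r \<in> unit_block d" "\<And>k. k < d \<Longrightarrow> odd (q k) \<Longrightarrow> (\<Prod>i=k..<d. odd_sign (r i)) = w k"
      "\<And>k. k < d \<Longrightarrow> even (q k) \<Longrightarrow> r k = 0"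
    using suffix_products_solvable[of d w "{k. odd (q k)}"] w by auto
  let ?step = "\<lambda>n b. b \<in> ran (iterated_block d (fold_subst d) n a)"
  have "?step 0 a" by (simp add: iterated_block_def)
  note iterated_block_step[OF this p(1)]
  define s where "s k = (if even (p k) then letter_sign a k
          else (\<Prod>i<k. odd_sign (p i)) * (\<Prod>i=k..<d. odd_sign (letter_parity d a i)))" for k
  have s: "s k = 1 \<or> s k = - 1" for k
    using prod_sign[of "{..<k}" "\<lambda>i. odd_sign (p i)"] odd_sign_sign
      prod_sign[of "{k..<d}" "\<lambda>i. odd_sign (letter_parity d a i)"]
    by (auto simp: s_def letter_sign_def)
  have "fold_subst d a p = letter d s p" by (simp add: fold_subst_def s_def[abs_def])
  with \<open>?step (Suc 0) (fold_subst d a p)\<close> have "?step 1 (letter d s p)" by simp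
  note iterated_block_step[OF this one(1)]
  moreover have "fold_subst d (letter d s p) one = letter d t one"
    by (subst fold_subst_letter[OF s], rule letter_cong) (simp_all add: one(2) p(2) odd_sign_one)
  ultimately have "?step 2 (letter d t one)" by (simp add: numeral_2_eq_2)
  note iterated_block_step[OF this r(1)]
  define s' where "s' k = (if even (r k) then t k
          else (\<Prod>i<k. odd_sign (r i)) * (\<Prod>i=k..<d. odd_sign (one i)))" for k
  have s': "s' k = 1 \<or> s' k = - 1" for k
    using prod_sign[of "{..<k}" "\<lambda>i. odd_sign (r i)"] odd_sign_sign
      prod_sign[of "{k..<d}" "\<lambda>i. odd_sign (one i)"] t[of k]
    by (auto simp: s'_def)
  have "fold_subst d (letter d t one) r = letter d s' r"
    by (subst fold_subst_letter[OF t]) (simp add: s'_def[abs_def])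
  with \<open>?step (Suc 2) (fold_subst d (letter d t one) r)\<close>
  have "?step 3 (letter d s' r)" by simp
  note iterated_block_step[OF this q]
  moreover have "fold_subst d (letter d s' r) q = letter d t q"
  proof (subst fold_subst_letter[OF s'], rule letter_cong)
    fix k assume k: "k < d"
    have "(\<Prod>i<k. odd_sign (q i)) * ((\<Prod>i<k. odd_sign (q i)) * t k) = t k"
      using prod_sign[of "{..<k}" "\<lambda>i. odd_sign (q i)"] odd_sign_sign by auto
    then show "(if even (q k) then s' k
        else (\<Prod>i<k. odd_sign (q i)) * (\<Prod>i=k..<d. odd_sign (r i))) = t k"
      using r(2,3)[OF k] by (auto simp: s'_def w_def mult_ac)
  qed simp
  ultimately show "b \<in> ran (iterated_block d (fold_subst d) 4 a)" by (simp add: b_eq)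
qed

section \<open>The iterates of the seed\<close>

lemma cube_inner:
  assumes "x \<in> cube d n" and "k < d"
  shows "(k, x) \<in> inner_faces d (2 ^ Suc n)"
proof -
  have x: "- (2 ^ n) \<le> x i" "x i \<le> 2 ^ n - 1" if "i < d" for i
    using that assms(1) by (auto simp: cube_def PiE_iff)
  have pos: "(0::int) < 2 ^ n" by simp
  have bounds: "- (2 ^ Suc n) < x i" "x i < 2 ^ Suc n" "x i + 1 \<le> 2 ^ Suc n" if "i < d" for i
    using x[OF that] pos unfolding power_Suc by linarith+
  have "x \<in> points d" using assms(1) by (simp add: points_def cube_def PiE_iff)
  then show ?thesis
    unfolding inner_faces_def using assms(2) bounds by (simp add: less_imp_le del: power_Suc)
qed

lemma cube_half:
  assumes "y \<in> cube d (Suc n)"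
  shows "(\<lambda>i\<in>{..<d}. y i div 2) \<in> cube d n"
proof -
  have half: "- N \<le> a div 2 \<and> a div 2 \<le> N - 1" if "- (2 * N) \<le> a" "a \<le> 2 * N - 1" for a N :: int
    using that by presburger
  have "- (2 * 2 ^ n) \<le> y i" "y i \<le> 2 * 2 ^ n - 1" if "i < d" for i
    using that assms by (auto simp: cube_def PiE_iff)
  from half[OF this] show ?thesis by (simp add: cube_def)
qed

text \<open>
  The substitution rule is exactly the pair of recursions for even and odd hyperplanes. The closed
  form for the latter holds from \<open>S\<^sub>d(3)\<close> on, which matches the shift by \<open>2\<close>: the pattern on the
  right-hand side is \<open>S\<^sub>d(n + 3)\<close>.
\<close>

lemma subst_letter_step:
  assumes y: "y \<in> cube d (Suc n)"
  shows "fold_subst d (letter d (\<lambda>k. fold_sign d (n + 2) k (\<lambda>i\<in>{..<d}. y i div 2)) (\<lambda>i\<in>{..<d}. y i div 2))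
      (\<lambda>i\<in>{..<d}. y i mod 2) = letter d (\<lambda>k. fold_sign d (Suc n + 2) k y) y"
proof (subst fold_subst_letter[OF fold_sign_sign], rule letter_cong)
  let ?x = "\<lambda>i\<in>{..<d}. y i div 2" and ?\<delta> = "\<lambda>i\<in>{..<d}. y i mod 2"
  fix k assume k: "k < d"
  show "odd (?\<delta> k) = odd (y k)" using k by simp
  have inner: "(k, y) \<in> inner_faces d (2 ^ Suc (Suc n))" using cube_inner[OF y k] .
  have bits: "(\<Prod>i<k. odd_sign (?\<delta> i)) = (\<Prod>i<k. odd_sign (y i))"
    "(\<Prod>i=k..<d. odd_sign (?x i)) = (\<Prod>i=k..<d. odd_sign (y i div 2))"
    using k by (auto simp: odd_sign_def intro!: prod.cong)
  show "(if even (?\<delta> k) then fold_sign d (n + 2) k ?x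
      else (\<Prod>i<k. odd_sign (?\<delta> i)) * (\<Prod>i=k..<d. odd_sign (?x i))) = fold_sign d (Suc n + 2) k y"
  proof (cases "even (y k)")
    case True
    have "\<bar>y k\<bar> < 2 ^ Suc (Suc n)" using inner by (auto simp: inner_faces_def)
    from fold_sign_even[of k d y "Suc n", OF k True this] show ?thesis using True k by simp
  next
    case False
    from fold_sign_odd[OF inner False] show ?thesis unfolding bits using False k by simp
  qed
qed

lemma produces_fold_subst:
  "produces_paperfolding d (letters d) (\<lambda>a k. crease_of (letter_sign a k)) (fold_subst d)"
  unfolding produces_paperfolding_def
proof (intro exI conjI allI ballI impI)
  let ?seed = "\<lambda>x. if x \<in> cube d 0 then Some (letter d (\<lambda>k. fold_sign d 2 k x) x) else None"
  show "dom ?seed = cube d 0" by (auto split: if_splits)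
  show "ran ?seed \<subseteq> letters d" by (auto simp: ran_def letter_in_letters)
  have iter: "(subst_array d (fold_subst d) ^^ n) ?seed x = Some (letter d (\<lambda>k. fold_sign d (n + 2) k x) x)"
    if "x \<in> cube d n" for n x
    using that
  proof (induction n arbitrary: x)
    case (Suc n)
    have "x \<in> points d" using Suc.prems by (simp add: cube_def points_def PiE_iff)
    then have "(subst_array d (fold_subst d) ^^ Suc n) ?seed x =
        map_option (\<lambda>a. fold_subst d a (\<lambda>i\<in>{..<d}. x i mod 2))
          ((subst_array d (fold_subst d) ^^ n) ?seed (\<lambda>i\<in>{..<d}. x i div 2))"
      unfolding funpow.simps o_apply subst_array_def by (rule if_P)
    also note Suc.IH[OF cube_half[OF Suc.prems]]
    finally show ?case unfolding option.map subst_letter_step[OF Suc.prems] .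
  qed (simp add: numeral_2_eq_2)
  fix n x k assume x: "x \<in> cube d n" and k: "k < d"
  show "(subst_array d (fold_subst d) ^^ n) ?seed x = Some (letter d (\<lambda>k. fold_sign d (n + 2) k x) x)"
    using iter[OF x] .
  show "paperfolding d (n + 2) (k, x) =
      Some (crease_of (letter_sign (letter d (\<lambda>k. fold_sign d (n + 2) k x) x) k))"
    unfolding letter_sign_letter[of k d "\<lambda>k. fold_sign d (n + 2) k x", OF k fold_sign_sign]
    using paperfolding_eq_fold_sign[OF cube_inner[OF x k]] by (simp only: add_2_eq_Suc')
qed

theorem theorem1:
  fixes d :: nat
  assumes "d \<ge> 1"
  shows "\<exists>(A :: nat set) (creases :: nat \<Rightarrow> nat \<Rightarrow> crease) (\<mu> :: nat substitution).
    block_substitution d A \<mu> \<and> primitive d A \<mu> \<and> produces_paperfolding d A creases \<mu>"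
  using block_substitution_fold_subst primitive_fold_subst produces_fold_subst by blast

end
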